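(* Let $Y$ be a finite dimensional Euclidean space, $K\subseteq Y$ a closed convex cone, $A:\mathbb{R}^m\to Y$ an injective linear map and $c\in\mathbb{R}^m$. Consider the conic linear system $$(D)\qquad A^*y=c,\quad y\in K^*.$$ Then: (1) $(D)$ is infeasible if and only if it has a reformulation $$\langle a_i',y\rangle=0\ (i=1,\dots,k),\qquad \langle a_{k+1}',y\rangle=-1,\qquad \langle a_i',y\rangle=c_i'\ (i=k+2,\dots,m),\qquad y\in K^*,$$ where $k\ge 0$ and $(a_1',\dots,a_{k+1}')\in \mathrm{FR}_{k+1}(K^* )$. (2) $(D)$ is not strongly infeasible if and only if there are $\ell\ge 0$ and $(y_1,\dots,y_{\ell+1})\in\mathrm{FR}_{\ell+1}(K)$ such that $A^*y_i=0$ for $i=1,\dots,\ell$ and $A^*y_{\ell+1}=c$.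
   Context: Notation: $K^*=\{y\in Y:\langle y,x\rangle\ge 0\ \forall x\in K\}$ is the dual cone (so $K^{**}=K$); $A^*$ is the adjoint of $A$. Write $Ax=\sum_{i=1}^m x_ia_i$ with $a_i\in Y$, so $A^*y=(\langle a_1,y\rangle,\dots,\langle a_m,y\rangle)^T$. Strong infeasibility: $(D)$ is called strongly infeasible if the alternative system $Ax\in K,\ \langle c,x\rangle=-1$ has a solution $x\in\mathbb{R}^m$. Facial reduction cone: for a closed convex cone $C\subseteq Y$ and an integer $k\ge1$, $$\mathrm{FR}_k(C)=\{(y_1,\dots,y_k): y_1\in C^*,\ y_i\in (C\cap y_1^\perp\cap\dots\cap y_{i-1}^\perp)^*,\ i=2,\dots,k\}.$$ Reformulation: a reformulation of the problem with data $(A,b,c)$ (where $b\in Y$ plays no role in the system $(D)$) is obtained by a finite sequence of the following operations: (i) replace $(a_i,c_i)$ by $(A\lambda,\langle c,\lambda\rangle)$ for some $i$, where $\lambda\in\mathbb{R}^m$, $\lambda_i\neq0$; (ii) switch $(a_i,c_i)$ with $(a_j,c_j)$, $i\ne j$; (iii) replace $b$ by $b+A\mu$ with $\mu\in\mathbb{R}^m$; and, only if $K=K^*$, (iv) replace $a_i$ by $Ta_i$ for all $i$ and $b$ by $Tb$, where $T:Y\to Y$ is an invertible linear map with $TK=K$. (The current data are used at each step.) *)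

theory Defs
  imports "HOL-Analysis.Analysis"
begin

text \<open>
  Vectors of \<open>\<real>\<^sup>m\<close> are the functions on \<open>{1..m}\<close>, extended by \<open>undefined\<close> outside, so that
  equality of functions is equality of vectors.  A linear map \<open>\<real>\<^sup>m \<rightarrow> Y\<close> is given by the family
  \<open>a 1, \<dots>, a m\<close> of its columns; values of \<open>a\<close> outside \<open>{1..m}\<close> are irrelevant.
\<close>

definition Rvec :: "nat \<Rightarrow> (nat \<Rightarrow> real) set" where
  "Rvec m = {1..m} \<rightarrow>\<^sub>E UNIV"

definition zero_vec :: "nat \<Rightarrow> nat \<Rightarrow> real" where
  "zero_vec m = (\<lambda>i\<in>{1..m}. 0)"

definition dot :: "nat \<Rightarrow> (nat \<Rightarrow> real) \<Rightarrow> (nat \<Rightarrow> real) \<Rightarrow> real" where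
  "dot m u v = (\<Sum>i=1..m. u i * v i)"

definition lin_map :: "nat \<Rightarrow> (nat \<Rightarrow> 'a::real_vector) \<Rightarrow> (nat \<Rightarrow> real) \<Rightarrow> 'a" where
  "lin_map m a x = (\<Sum>i=1..m. x i *\<^sub>R a i)"

definition adj_map :: "nat \<Rightarrow> (nat \<Rightarrow> 'a::real_inner) \<Rightarrow> 'a \<Rightarrow> nat \<Rightarrow> real" where
  "adj_map m a y = (\<lambda>i\<in>{1..m}. a i \<bullet> y)"

lemma adj_map_in_Rvec: "adj_map m a y \<in> Rvec m"
  by (simp add: adj_map_def Rvec_def)

lemma adj_map_adjoint: "dot m (adj_map m a y) x = y \<bullet> lin_map m a x"
  by (simp add: dot_def adj_map_def lin_map_def inner_sum_right inner_commute mult.commute)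

definition dual_cone :: "'a::real_inner set \<Rightarrow> 'a set" where
  "dual_cone K = {y. \<forall>x\<in>K. y \<bullet> x \<ge> 0}"

text \<open>Only the entries \<open>y 1, \<dots>, y k\<close> of the sequence \<open>y\<close> matter.\<close>

definition FR :: "nat \<Rightarrow> 'a::real_inner set \<Rightarrow> (nat \<Rightarrow> 'a) set" where
  "FR k C = {y. \<forall>i\<in>{1..k}. y i \<in> dual_cone (C \<inter> orthogonal_comp (y ` {1..<i}))}"

definition D_feasible :: "nat \<Rightarrow> 'a::real_inner set \<Rightarrow> (nat \<Rightarrow> 'a) \<Rightarrow> (nat \<Rightarrow> real) \<Rightarrow> bool" where
  "D_feasible m K a c \<longleftrightarrow> (\<exists>y\<in>dual_cone K. adj_map m a y = c)"

definition D_strongly_infeasible ::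
    "nat \<Rightarrow> 'a::real_inner set \<Rightarrow> (nat \<Rightarrow> 'a) \<Rightarrow> (nat \<Rightarrow> real) \<Rightarrow> bool" where
  "D_strongly_infeasible m K a c \<longleftrightarrow> (\<exists>x\<in>Rvec m. lin_map m a x \<in> K \<and> dot m c x = -1)"

type_synonym 'a data = "(nat \<Rightarrow> 'a) \<times> 'a \<times> (nat \<Rightarrow> real)"

inductive reform_step :: "nat \<Rightarrow> 'a::real_inner set \<Rightarrow> 'a data \<Rightarrow> 'a data \<Rightarrow> bool"
  for m :: nat and K :: "'a set" where
  combine: "i \<in> {1..m} \<Longrightarrow> l \<in> Rvec m \<Longrightarrow> l i \<noteq> 0 \<Longrightarrow>
    reform_step m K (a, b, c) (a(i := lin_map m a l), b, c(i := dot m c l))"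
| switch: "i \<in> {1..m} \<Longrightarrow> j \<in> {1..m} \<Longrightarrow> i \<noteq> j \<Longrightarrow>
    reform_step m K (a, b, c) (a(i := a j, j := a i), b, c(i := c j, j := c i))"
| shift: "\<mu> \<in> Rvec m \<Longrightarrow> reform_step m K (a, b, c) (a, b + lin_map m a \<mu>, c)"
| transform: "K = dual_cone K \<Longrightarrow> linear T \<Longrightarrow> bij T \<Longrightarrow> T ` K = K \<Longrightarrow>
    reform_step m K (a, b, c) (\<lambda>i. T (a i), T b, c)"

definition reformulation :: "nat \<Rightarrow> 'a::real_inner set \<Rightarrow> 'a data \<Rightarrow> 'a data \<Rightarrow> bool" where
  "reformulation m K = (reform_step m K)\<^sup>*\<^sup>*"

end

theory Submission
  imports Defs
begin

text \<open>
  Let \<open>R\<close> be the span of \<open>a 1, \<dots>, a m\<close>. Since the \<open>a i\<close> are independent there is a vector \<open>y0\<close>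
  with \<open>a i \<bullet> y0 = c i\<close> for all \<open>i\<close>, so that \<open>A\<^sup>*y = 0\<close> says \<open>y \<in> R\<^sup>\<bottom>\<close> and \<open>A\<^sup>*y = c\<close> says
  \<open>y - y0 \<in> R\<^sup>\<bottom>\<close>. After this translation both parts are instances of one statement about a convex
  cone \<open>C\<close>, a subspace \<open>W\<close> and a vector \<open>f\<close>, the lemma \<open>facial_reduction\<close>: if \<open>f\<close> is nonnegative on
  \<open>C \<inter> W\<^sup>\<bottom>\<close>, then there is a facial reduction sequence for \<open>C\<close> all of whose members lie in \<open>W\<close>,
  except for the last one, which lies in \<open>f + W\<close>. Under the constraint qualification that the
  relative interior of \<open>C\<close> meets \<open>W\<^sup>\<bottom>\<close>, one has \<open>f \<in> C\<^sup>* + W\<close> and a sequence of length one suffices.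
  In general a separation argument (\<open>facial_reduction_step\<close>) yields either such a decomposition or a
  vector of \<open>C\<^sup>* \<inter> W\<close> that exposes a proper face of \<open>C\<close>; the hypothesis is inherited by the face,
  which has smaller dimension.

  \<^item> \<^bold>\<open>Part 2.\<close> Scaling shows that \<open>(D)\<close> is not strongly infeasible iff \<open>y0\<close> is nonnegative on
    \<open>K \<inter> R\<close>. Take \<open>C = K\<close>, \<open>W = R\<^sup>\<bottom>\<close> and \<open>f = y0\<close>.
  \<^item> \<^bold>\<open>Part 1.\<close> Take \<open>C = K\<^sup>*\<close> and \<open>W = R \<inter> y0\<^sup>\<bottom>\<close>. If \<open>(D)\<close> is infeasible then \<open>y0 \<notin> R\<^sup>\<bottom>\<close>, because
    otherwise \<open>0\<close> is a solution; choose \<open>f \<in> R\<close> with \<open>f \<bullet> y0 = -1\<close>. A vector of \<open>C \<inter> W\<^sup>\<bottom>\<close> at which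
    \<open>f\<close> is negative would scale to a solution of \<open>(D)\<close>. The members of the resulting sequence lie in
    \<open>R\<close> and have inner products \<open>0, \<dots>, 0, -1\<close> with \<open>y0\<close>. They are linearly independent: each
    of the first \<open>k\<close> is positive somewhere on a face to which its predecessors are orthogonal, and
    the last one is distinguished by its inner product with \<open>y0\<close>. As in Gaussian
    elimination, combinations and switches bring them into the first \<open>k + 1\<close> positions
    (\<open>reformulation_to_independent_sequence\<close>).

  The converses are short: a solution of the system in question is orthogonal to all but the last
  member of the sequence, hence lies in the last face, where the last member is nonnegative
  (\<open>FR_last_nonneg\<close>), contradicting the value \<open>-1\<close>. For part 1, reformulations moreover preserve
  feasibility (\<open>reform_step_feasible\<close>).
\<close>

(* Index sets start at 1; with this the simplifier leaves them in the form {1..m}. *)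
declare One_nat_def [simp del]

section \<open>Facial reduction\<close>

lemma orthogonal_comp_iff: "x \<in> orthogonal_comp W \<longleftrightarrow> (\<forall>w\<in>W. w \<bullet> x = 0)"
  by (simp add: orthogonal_comp_def orthogonal_def)

lemma convex_cone_dual_cone: "convex_cone (dual_cone K)"
  by (auto simp: convex_cone_iff dual_cone_def inner_add_left)

lemma convex_cone_Int_orthogonal_comp:
  assumes "convex_cone C" shows "convex_cone (C \<inter> orthogonal_comp W)"
  using assms by (auto simp: convex_cone_iff orthogonal_comp_iff inner_add_right)

text \<open>
  The origin is separated properly, inside the space extended by one coordinate for a height, from
  the sum of \<open>C\<close> at height 0 and the epigraph of \<open>f\<close> on \<open>W\<^sup>\<bottom>\<close>, reflected in its first
  component. If the separating hyperplane is not vertical, it can be normalised and gives the first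
  alternative. If it is vertical, properness of the separation gives the second one.
\<close>

lemma facial_reduction_step:
  fixes C W :: "'a::euclidean_space set"
  assumes C: "convex_cone C" and W: "subspace W"
    and nonneg: "\<And>x. x \<in> C \<inter> orthogonal_comp W \<Longrightarrow> 0 \<le> f \<bullet> x"
  shows "(\<exists>y\<in>dual_cone C. y - f \<in> W) \<or>
         (\<exists>y\<in>dual_cone C \<inter> W. \<exists>x\<in>C. 0 < y \<bullet> x)"
proof -
  define S where "S = orthogonal_comp W"
  have S: "subspace S" and SW: "orthogonal_comp S = W"
    by (simp_all add: S_def subspace_orthogonal_comp orthogonal_comp_self W)
  define D where "D = {(x - s, r) |x s r. x \<in> C \<and> s \<in> S \<and> f \<bullet> s \<le> r}"
  have D: "convex_cone D"
    unfolding convex_cone_iff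
  proof (intro conjI ballI allI impI)
    show "0 \<in> D"
      using convex_cone_contains_0[OF C] subspace_0[OF S]
      by (auto simp: D_def zero_prod_def intro!: exI[of _ 0])
  next
    fix p q assume "p \<in> D" "q \<in> D"
    then obtain x s r x' s' r' where p: "p = (x - s, r)" "x \<in> C" "s \<in> S" "f \<bullet> s \<le> r"
      and q: "q = (x' - s', r')" "x' \<in> C" "s' \<in> S" "f \<bullet> s' \<le> r'"
      by (auto simp: D_def)
    have "p + q = ((x + x') - (s + s'), r + r')" using p q by simp
    moreover have "x + x' \<in> C" using convex_cone_add[OF C] p q by blast
    moreover have "s + s' \<in> S" using subspace_add[OF S] p q by blast
    moreover have "f \<bullet> (s + s') \<le> r + r'" using p q by (simp add: inner_add_right)
    ultimately show "p + q \<in> D" unfolding D_def by blast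
  next
    fix p and t :: real assume "p \<in> D" and t: "0 \<le> t"
    then obtain x s r where p: "p = (x - s, r)" "x \<in> C" "s \<in> S" "f \<bullet> s \<le> r"
      by (auto simp: D_def)
    have "t *\<^sub>R p = (t *\<^sub>R x - t *\<^sub>R s, t * r)" using p by (simp add: scaleR_diff_right)
    moreover have "t *\<^sub>R x \<in> C" using convex_cone_scaleR[OF C] p t by blast
    moreover have "t *\<^sub>R s \<in> S" using subspace_scale[OF S] p by blast
    moreover have "f \<bullet> (t *\<^sub>R s) \<le> t * r" using p t by (simp add: mult_left_mono)
    ultimately show "t *\<^sub>R p \<in> D" unfolding D_def by blast
  qed
  have below: "r \<ge> 0" if "(0, r) \<in> D" for r
  proof -
    from that obtain s where "s \<in> C" "s \<in> S" "f \<bullet> s \<le> r" by (auto simp: D_def)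
    with nonneg[of s] show ?thesis by (simp add: S_def)
  qed
  have convD: "convex D" using D by (simp add: convex_cone_def)
  have inD: "(x - s, r) \<in> D" if "x \<in> C" "s \<in> S" "f \<bullet> s \<le> r" for x s r
    using that by (auto simp: D_def)
  have C0: "0 \<in> C" and S0: "0 \<in> S"
    using convex_cone_contains_0[OF C] subspace_0[OF S] by auto
  have zeroD: "0 \<in> D" using convex_cone_contains_0[OF D] .
  \<comment> \<open>A relative interior point can be left in the direction opposite to any point of the set;
      for the origin and \<open>(0, 1)\<close> this would end at a height below 0.\<close>
  have "0 \<notin> rel_interior D"
  proof
    assume "0 \<in> rel_interior D"
    moreover have "(0, 1) \<in> D" using inD[of 0 0 1] C0 S0 by simp
    ultimately obtain e where e: "e > 1" "(1 - e) *\<^sub>R (0, 1) + e *\<^sub>R 0 \<in> D"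
      using convex_rel_interior_iff[OF convD] zeroD by blast
    then show False using below[of "1 - e"] by simp
  qed
  then obtain p where p: "\<And>q. q \<in> D \<Longrightarrow> 0 \<le> p \<bullet> q" "\<And>q. q \<in> rel_interior D \<Longrightarrow> 0 < p \<bullet> q"
    using supporting_hyperplane_rel_boundary[OF convD zeroD] by (metis inner_zero_right)
  obtain u \<beta> where u: "p = (u, \<beta>)" by (cases p)
  have le: "0 \<le> u \<bullet> (x - s) + \<beta> * r" if "x \<in> C" "s \<in> S" "f \<bullet> s \<le> r" for x s r
    using p(1)[OF inD[OF that]] by (simp add: u)
  have \<beta>: "0 \<le> \<beta>" using le[OF C0 S0, of 1] by simp
  have uC: "u \<in> dual_cone C"
    using le[OF _ S0, of _ 0] by (simp add: dual_cone_def)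
  have uW: "u - \<beta> *\<^sub>R f \<in> W"
  proof -
    have "s \<bullet> (u - \<beta> *\<^sub>R f) = 0" if s: "s \<in> S" for s
    proof -
      have "- s \<in> S" using subspace_neg[OF S s] .
      then show ?thesis
        using le[OF C0 s, of "f \<bullet> s"] le[OF C0, of "- s" "- (f \<bullet> s)"]
        by (simp add: inner_diff_right inner_commute)
    qed
    then have "u - \<beta> *\<^sub>R f \<in> orthogonal_comp S" by (simp add: orthogonal_comp_iff)
    then show ?thesis by (simp add: SW)
  qed
  show ?thesis
  proof (cases "\<beta> = 0")
    case False
    have "(1 / \<beta>) *\<^sub>R u \<in> dual_cone C"
      using convex_cone_scaleR[OF convex_cone_dual_cone _ uC] \<beta> by simp
    moreover have "(1 / \<beta>) *\<^sub>R u - f \<in> W"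
      using subspace_scale[OF W uW, of "1 / \<beta>"] False by (simp add: scaleR_diff_right)
    ultimately show ?thesis by blast
  next
    case True
    then have uW': "u \<in> W" using uW by simp
    obtain q where q: "q \<in> rel_interior D"
      using rel_interior_eq_empty[OF convD] zeroD by blast
    then obtain x s r where xs: "q = (x - s, r)" "x \<in> C" "s \<in> S"
      using rel_interior_subset[of D] by (auto simp: D_def)
    have "u \<bullet> s = 0" using xs(3) uW' by (simp add: S_def orthogonal_comp_iff)
    then have "0 < u \<bullet> x" using p(2)[OF q] True by (simp add: u xs inner_diff_right)
    then show ?thesis using uC uW' xs(2) by blast
  qed
qed

text \<open>
  Induction on the dimension of the span of \<open>C\<close>: in the second alternative of the step,
  \<open>C\<close> is replaced by the face \<open>C \<inter> {u}\<^sup>\<bottom>\<close>, and \<open>u\<close> is put in front of a sequence for the face. The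
  last conjunct records that every reduction was strict; linear independence is read off from it.
\<close>

lemma facial_reduction:
  fixes C W :: "'a::euclidean_space set"
  assumes "convex_cone C" and W: "subspace W"
    and "\<And>x. x \<in> C \<inter> orthogonal_comp W \<Longrightarrow> 0 \<le> f \<bullet> x"
  shows "\<exists>l y. y \<in> FR (l + 1) C \<and> (\<forall>i\<in>{1..l}. y i \<in> W) \<and> y (l + 1) - f \<in> W \<and>
           (\<forall>i\<in>{1..l}. \<exists>x\<in>C \<inter> orthogonal_comp (y ` {1..<i}). 0 < y i \<bullet> x)"
  using assms(1,3)
proof (induction "dim C" arbitrary: C rule: less_induct)
  case less
  consider (represented) y where "y \<in> dual_cone C" "y - f \<in> W"
    | (reduce) u v where "u \<in> dual_cone C" "u \<in> W" "v \<in> C" "0 < u \<bullet> v"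
    using facial_reduction_step[OF less.prems(1) W less.prems(2)] by blast
  then show ?case
  proof cases
    case represented
    then show ?thesis
      by (intro exI[of _ 0] exI[of _ "\<lambda>_. y"]) (simp add: FR_def orthogonal_comp_def)
  next
    case reduce
    define C' where "C' = C \<inter> orthogonal_comp {u}"
    have "span C' \<subset> span C"
    proof -
      have "span C' \<subseteq> orthogonal_comp {u}"
        by (intro span_minimal subspace_orthogonal_comp) (simp add: C'_def)
      then have "v \<notin> span C'" using reduce(4) by (auto simp: orthogonal_comp_iff)
      moreover have "v \<in> span C" using reduce(3) by (rule span_base)
      moreover have "span C' \<subseteq> span C" by (intro span_mono) (simp add: C'_def)
      ultimately show ?thesis by blast
    qed
    then have "dim C' < dim C" by (rule dim_psubset)
    moreover have "convex_cone C'"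
      unfolding C'_def by (rule convex_cone_Int_orthogonal_comp[OF less.prems(1)])
    moreover have "0 \<le> f \<bullet> x" if "x \<in> C' \<inter> orthogonal_comp W" for x
      using that less.prems(2) by (simp add: C'_def)
    ultimately obtain l z where z: "z \<in> FR (l + 1) C'" "\<forall>i\<in>{1..l}. z i \<in> W" "z (l + 1) - f \<in> W"
      "\<forall>i\<in>{1..l}. \<exists>x\<in>C' \<inter> orthogonal_comp (z ` {1..<i}). 0 < z i \<bullet> x"
      using less.hyps by blast
    define y where "y i = (if i = 1 then u else z (i - 1))" for i
    have y1: "y 1 = u" by (simp add: y_def)
    have yS: "y (Suc i) = z i" if "i \<ge> 1" for i using that by (simp add: y_def)
    have face: "C \<inter> orthogonal_comp (y ` {1..<Suc i}) = C' \<inter> orthogonal_comp (z ` {1..<i})"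
      if "i \<ge> 1" for i
    proof -
      have "{1..<Suc i} = insert 1 (Suc ` {1..<i})"
        using that by (auto simp: image_Suc_atLeastLessThan)
      moreover have "y ` Suc ` {1..<i} = z ` {1..<i}"
        unfolding image_image by (intro image_cong) (auto simp: y_def)
      ultimately have "y ` {1..<Suc i} = insert u (z ` {1..<i})"
        using y1 by (simp only: image_insert)
      then show ?thesis by (auto simp: C'_def orthogonal_comp_iff)
    qed
    have shift: "P i" if P: "P 1" "\<And>j. j \<in> {1..n} \<Longrightarrow> P (Suc j)" and i: "i \<in> {1..Suc n}" for P n and i :: nat
    proof (cases "i = 1")
      case False
      then obtain j where "i = Suc j" "j \<in> {1..n}" using i by (cases i) auto
      then show ?thesis using P(2) by blast
    qed (use P in simp)
    have "y \<in> FR (Suc l + 1) C"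
      unfolding FR_def mem_Collect_eq
    proof
      fix i assume i: "i \<in> {1..Suc l + 1}"
      show "y i \<in> dual_cone (C \<inter> orthogonal_comp (y ` {1..<i}))"
      proof (rule shift[where n = "Suc l"])
        show "y 1 \<in> dual_cone (C \<inter> orthogonal_comp (y ` {1..<1}))"
          using reduce(1) by (simp add: y_def orthogonal_comp_def)
      next
        fix j assume j: "j \<in> {1..Suc l}"
        then have "z j \<in> dual_cone (C' \<inter> orthogonal_comp (z ` {1..<j}))"
          using z(1) by (simp add: FR_def)
        then show "y (Suc j) \<in> dual_cone (C \<inter> orthogonal_comp (y ` {1..<Suc j}))"
          using j by (simp add: face[simplified] yS)
      qed (use i in simp)
    qed
    moreover have "\<forall>i\<in>{1..Suc l}. y i \<in> W"
    proof
      fix i assume "i \<in> {1..Suc l}"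
      with z(2) reduce(2) show "y i \<in> W"
        by (cases i) (auto simp: y_def)
    qed
    moreover have "y (Suc l + 1) - f \<in> W" using z(3) by (simp add: y_def)
    moreover have "\<forall>i\<in>{1..Suc l}. \<exists>x\<in>C \<inter> orthogonal_comp (y ` {1..<i}). 0 < y i \<bullet> x"
    proof
      fix i assume i: "i \<in> {1..Suc l}"
      show "\<exists>x\<in>C \<inter> orthogonal_comp (y ` {1..<i}). 0 < y i \<bullet> x"
      proof (rule shift[where n = l])
        show "\<exists>x\<in>C \<inter> orthogonal_comp (y ` {1..<1}). 0 < y 1 \<bullet> x"
          using reduce(3,4) by (auto simp: y_def orthogonal_comp_def)
      next
        fix j assume j: "j \<in> {1..l}"
        then show "\<exists>x\<in>C \<inter> orthogonal_comp (y ` {1..<Suc j}). 0 < y (Suc j) \<bullet> x"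
          using z(4) by (simp add: face[simplified] yS)
      qed (use i in simp)
    qed
    ultimately show ?thesis by blast
  qed
qed

lemma FR_last_nonneg:
  assumes "y \<in> FR (k + 1) C" "x \<in> C" "\<And>i. i \<in> {1..k} \<Longrightarrow> y i \<bullet> x = 0"
  shows "0 \<le> y (k + 1) \<bullet> x"
proof -
  have "x \<in> C \<inter> orthogonal_comp (y ` {1..<k + 1})"
    using assms(2,3) by (auto simp: orthogonal_comp_iff)
  moreover have "y (k + 1) \<in> dual_cone (C \<inter> orthogonal_comp (y ` {1..<k + 1}))"
    using assms(1) by (simp add: FR_def)
  ultimately show ?thesis by (simp add: dual_cone_def)
qed

section \<open>The range of the linear map and the right-hand side\<close>

lemma lin_map_restrict: "lin_map m a (restrict l {1..m}) = lin_map m a l"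
  by (simp add: lin_map_def)

lemma lin_map_in_span: "lin_map m a l \<in> span (a ` {1..m})"
  unfolding lin_map_def by (intro span_sum span_scale span_base imageI)

lemma range_lin_map: "lin_map m a ` Rvec m = span (a ` {1..m})"
proof
  show "lin_map m a ` Rvec m \<subseteq> span (a ` {1..m})"
    using lin_map_in_span by blast
  have eq: "lin_map m a ` Rvec m = range (lin_map m a)"
  proof -
    have "lin_map m a l \<in> lin_map m a ` Rvec m" for l
      by (rule image_eqI[of _ _ "restrict l {1..m}"]) (simp_all add: Rvec_def lin_map_restrict)
    then show ?thesis by blast
  qed
  have add: "lin_map m a u + lin_map m a v = lin_map m a (\<lambda>i. u i + v i)" for u v
    by (simp add: lin_map_def scaleR_add_left sum.distrib)
  have scale: "r *\<^sub>R lin_map m a u = lin_map m a (\<lambda>i. r * u i)" for r u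
    by (simp add: lin_map_def scaleR_sum_right)
  have zero: "0 \<in> range (lin_map m a)"
    by (rule range_eqI[of _ _ "\<lambda>i. 0"]) (simp add: lin_map_def)
  have "subspace (range (lin_map m a))"
  proof (rule subspaceI)
    show "0 \<in> range (lin_map m a)" by (fact zero)
  qed (auto simp: add scale)
  moreover have "a i = lin_map m a (\<lambda>j. if j = i then 1 else 0)" if "i \<in> {1..m}" for i
    using that by (simp add: lin_map_def if_distrib[of "\<lambda>t. t *\<^sub>R _"] sum.delta cong: if_cong)
  ultimately show "span (a ` {1..m}) \<subseteq> lin_map m a ` Rvec m"
    unfolding eq by (intro span_minimal) auto
qed

lemma in_orthogonal_comp_span_iff:
  "x \<in> orthogonal_comp (span (a ` I)) \<longleftrightarrow> (\<forall>i\<in>I. a i \<bullet> x = 0)"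
proof
  assume "x \<in> orthogonal_comp (span (a ` I))"
  then show "\<forall>i\<in>I. a i \<bullet> x = 0" by (auto simp: orthogonal_comp_iff span_base)
next
  assume *: "\<forall>i\<in>I. a i \<bullet> x = 0"
  have "span (a ` I) \<subseteq> orthogonal_comp {x}"
    by (intro span_minimal subspace_orthogonal_comp)
       (use * in \<open>auto simp: orthogonal_comp_iff inner_commute\<close>)
  then show "x \<in> orthogonal_comp (span (a ` I))"
    by (auto simp: orthogonal_comp_iff inner_commute)
qed

lemma adj_map_eq_iff:
  "c \<in> Rvec m \<Longrightarrow> adj_map m a y = c \<longleftrightarrow> (\<forall>i\<in>{1..m}. a i \<bullet> y = c i)"
  by (auto simp: adj_map_def Rvec_def fun_eq_iff PiE_iff extensional_def)

lemma inner_lin_map: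
  assumes "\<And>i. i \<in> {1..m} \<Longrightarrow> a i \<bullet> y = c i"
  shows "lin_map m a l \<bullet> y = dot m c l"
  using assms by (simp add: lin_map_def dot_def inner_sum_left mult.commute)

text \<open>
  The adjoint of an injective linear map is surjective: a linear functional may be prescribed on the
  independent vectors \<open>a i\<close>, and it is represented by a vector.
\<close>

lemma exists_preimage_adjoint:
  fixes a :: "nat \<Rightarrow> 'a::euclidean_space"
  assumes inj: "inj_on (lin_map m a) (Rvec m)"
  obtains y0 where "\<And>i. i \<in> {1..m} \<Longrightarrow> a i \<bullet> y0 = c i"
proof -
  have coeff: "u i = v i" if "lin_map m a u = lin_map m a v" and i: "i \<in> {1..m}" for u v i
  proof -
    have "restrict u {1..m} = restrict v {1..m}"
    proof (rule inj_onD[OF inj])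
      show "lin_map m a (restrict u {1..m}) = lin_map m a (restrict v {1..m})"
        using that(1) by (simp only: lin_map_restrict)
    qed (simp_all add: Rvec_def)
    from fun_cong[OF this, of i] i show ?thesis by simp
  qed
  have inja: "inj_on a {1..m}"
  proof
    fix i j assume ij: "i \<in> {1..m}" "j \<in> {1..m}" "a i = a j"
    have unit: "lin_map m a (\<lambda>p. if p = q then 1 else 0) = a q" if "q \<in> {1..m}" for q
      using that by (simp add: lin_map_def if_distrib[of "\<lambda>t. t *\<^sub>R _"] sum.delta cong: if_cong)
    have "lin_map m a (\<lambda>p. if p = i then 1 else 0) = lin_map m a (\<lambda>p. if p = j then 1 else 0)"
      by (simp only: unit ij)
    from coeff[OF this ij(1)] show "i = j" by (simp split: if_splits)
  qed
  have "independent (a ` {1..m})"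
  proof (rule independent_if_scalars_zero)
    fix u v assume sum0: "(\<Sum>x\<in>a ` {1..m}. u x *\<^sub>R x) = 0" and v: "v \<in> a ` {1..m}"
    have "lin_map m a (\<lambda>i. u (a i)) = lin_map m a (\<lambda>i. 0)"
      using sum0 by (simp add: lin_map_def sum.reindex[OF inja])
    from coeff[OF this] show "u v = 0" using v by auto
  qed simp
  from linear_independent_extend[OF this, of "\<lambda>x. c (inv_into {1..m} a x)"]
  obtain g :: "'a \<Rightarrow> real"
    where g: "linear g" "\<forall>x\<in>a ` {1..m}. g x = c (inv_into {1..m} a x)" by blast
  have "a i \<bullet> adjoint g 1 = c i" if i: "i \<in> {1..m}" for i
  proof -
    have "a i \<bullet> adjoint g 1 = g (a i) \<bullet> 1" by (rule adjoint_works[OF g(1)])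
    also have "g (a i) = c (inv_into {1..m} a (a i))" using g(2) i by blast
    also have "inv_into {1..m} a (a i) = i" by (rule inv_into_f_f[OF inja i])
    finally show ?thesis by (simp only: inner_real_def mult_1_right)
  qed
  then show thesis by (rule that)
qed

section \<open>Reformulations\<close>

text \<open>
  Under combinations, switches and shifts, every solution remains a solution. Under a transformation \<open>T\<close> the
  solution is moved by the adjoint of \<open>T\<^sup>-\<^sup>1\<close>, which maps \<open>K\<^sup>*\<close> into itself because \<open>T\<^sup>-\<^sup>1\<close> maps \<open>K\<close>
  into itself.
\<close>

lemma reform_step_feasible:
  fixes K :: "'a::euclidean_space set"
  assumes "reform_step m K d d'" and "\<exists>y\<in>dual_cone K. \<forall>i\<in>{1..m}. fst d i \<bullet> y = snd (snd d) i"
  shows "\<exists>y\<in>dual_cone K. \<forall>i\<in>{1..m}. fst d' i \<bullet> y = snd (snd d') i"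
  using assms
proof (induction rule: reform_step.induct)
  case (combine i l a b c)
  from combine.prems obtain y where y: "y \<in> dual_cone K" "\<forall>i\<in>{1..m}. a i \<bullet> y = c i"
    unfolding fst_conv snd_conv by blast
  then have "lin_map m a l \<bullet> y = dot m c l" by (intro inner_lin_map) blast
  with y(2) have "\<forall>p\<in>{1..m}. (a(i := lin_map m a l)) p \<bullet> y = (c(i := dot m c l)) p" by simp
  with y(1) show ?case unfolding fst_conv snd_conv by blast
next
  case (switch i j a b c)
  from switch.prems obtain y where y: "y \<in> dual_cone K" "\<forall>i\<in>{1..m}. a i \<bullet> y = c i"
    unfolding fst_conv snd_conv by blast
  with switch(1,2) have "\<forall>p\<in>{1..m}. (a(i := a j, j := a i)) p \<bullet> y = (c(i := c j, j := c i)) p"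
    by simp
  with y(1) show ?case unfolding fst_conv snd_conv by blast
next
  case (shift \<mu> a b c)
  then show ?case by simp
next
  case (transform T a b c)
  from transform.prems obtain y where y: "y \<in> dual_cone K" "\<forall>i\<in>{1..m}. a i \<bullet> y = c i"
    unfolding fst_conv snd_conv by blast
  define S where "S = inv T"
  have S: "linear S"
    unfolding S_def using transform(2,3) by (metis bij_is_inj bij_is_surj inj_linear_imp_inv_linear)
  have ST: "S (T x) = x" for x
    unfolding S_def using transform(3) by (simp add: bij_is_inj)
  have "adjoint S y \<in> dual_cone K"
    unfolding dual_cone_def mem_Collect_eq
  proof
    fix x assume "x \<in> K"
    then obtain w where "w \<in> K" "x = T w" using transform(4) by blast
    then have "x \<bullet> adjoint S y = w \<bullet> y" by (simp add: adjoint_works[OF S] ST)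
    then show "0 \<le> adjoint S y \<bullet> x"
      using y(1) \<open>w \<in> K\<close> by (simp add: dual_cone_def inner_commute)
  qed
  moreover have "\<forall>i\<in>{1..m}. T (a i) \<bullet> adjoint S y = c i"
    using y(2) by (simp add: adjoint_works[OF S] ST)
  ultimately show ?case unfolding fst_conv snd_conv by blast
qed

lemma reformulation_feasible:
  fixes K :: "'a::euclidean_space set"
  assumes "reformulation m K (a, b, c) (a', b', c')"
    and "\<exists>y\<in>dual_cone K. \<forall>i\<in>{1..m}. a i \<bullet> y = c i"
  shows "\<exists>y\<in>dual_cone K. \<forall>i\<in>{1..m}. a' i \<bullet> y = c' i"
proof -
  let ?feasible = "\<lambda>d. \<exists>y\<in>dual_cone K. \<forall>i\<in>{1..m}. fst d i \<bullet> y = snd (snd d) i"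
  have "?feasible d'" if "(reform_step m K)\<^sup>*\<^sup>* d d'" "?feasible d" for d d'
    using that
  proof (induction rule: rtranclp_induct)
    case (step d1 d2)
    show ?case by (rule reform_step_feasible[OF step.hyps(2) step.IH[OF step.prems]])
  qed
  from this[of "(a, b, c)" "(a', b', c')"] show ?thesis
    using assms by (simp add: reformulation_def)
qed

lemma span_exchange:
  fixes a :: "nat \<Rightarrow> 'a::real_vector"
  assumes i: "i \<in> {1..m}" and li: "l i \<noteq> 0"
  shows "span (a(i := lin_map m a l) ` {1..m}) = span (a ` {1..m})"
proof
  let ?a = "a(i := lin_map m a l)"
  show "span (?a ` {1..m}) \<subseteq> span (a ` {1..m})"
    by (intro span_minimal) (auto simp: span_base intro: lin_map_in_span)
  have "lin_map m a l = l i *\<^sub>R a i + (\<Sum>j\<in>{1..m} - {i}. l j *\<^sub>R a j)"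
    unfolding lin_map_def by (rule sum.remove) (use i in auto)
  also have "(\<Sum>j\<in>{1..m} - {i}. l j *\<^sub>R a j) = (\<Sum>j\<in>{1..m} - {i}. l j *\<^sub>R ?a j)"
    by (intro sum.cong) auto
  finally have "a i = (1 / l i) *\<^sub>R (?a i - (\<Sum>j\<in>{1..m} - {i}. l j *\<^sub>R ?a j))"
    using li by simp
  also have "\<dots> \<in> span (?a ` {1..m})"
    by (intro span_scale span_diff span_sum span_base imageI) (use i in auto)
  finally have "a i \<in> span (?a ` {1..m})" .
  moreover have "a j \<in> span (?a ` {1..m})" if "j \<in> {1..m}" "j \<noteq> i" for j
    using span_base[of "?a j" "?a ` {1..m}"] that by auto
  ultimately show "span (a ` {1..m}) \<subseteq> span (?a ` {1..m})"
    by (intro span_minimal) (auto, metis)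
qed

text \<open>
  The sequence is moved into place one vector at a time. When \<open>z 1, \<dots>, z n\<close> occupy the first places,
  the next vector is a combination of the current ones, and by independence some coefficient beyond
  position \<open>n\<close> is nonzero. At that position the combination may replace the old vector, and a switch
  brings it to position \<open>n + 1\<close>. The vector \<open>y0\<close> keeps track of the right-hand sides.
\<close>

lemma reformulation_to_independent_sequence:
  fixes a z :: "nat \<Rightarrow> 'a::euclidean_space"
  assumes y0: "\<And>i. i \<in> {1..m} \<Longrightarrow> a i \<bullet> y0 = c i"
    and z: "\<And>i. i \<in> {1..n} \<Longrightarrow> z i \<in> span (a ` {1..m})"
    and indep: "\<And>i. i \<in> {1..n} \<Longrightarrow> z i \<notin> span (z ` {1..<i})"
  shows "n \<le> m \<and> (\<exists>a' c'. reformulation m K (a, b, c) (a', b, c') \<and>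
           (\<forall>i\<in>{1..n}. a' i = z i) \<and> span (a' ` {1..m}) = span (a ` {1..m}) \<and>
           (\<forall>i\<in>{1..m}. c' i = a' i \<bullet> y0))"
  using z indep
proof (induction n)
  case 0
  show ?case
    using y0 by (auto simp: reformulation_def intro!: exI[of _ a] exI[of _ c])
next
  case (Suc n)
  then obtain a' c' where n: "n \<le> m" and ref: "reformulation m K (a, b, c) (a', b, c')"
    and a': "\<forall>i\<in>{1..n}. a' i = z i" and spn: "span (a' ` {1..m}) = span (a ` {1..m})"
    and c': "\<forall>i\<in>{1..m}. c' i = a' i \<bullet> y0"
    by auto
  have "z (Suc n) \<in> lin_map m a' ` Rvec m"
    using Suc.prems(1)[of "Suc n"] by (simp add: range_lin_map spn)
  then obtain l where l: "l \<in> Rvec m" "z (Suc n) = lin_map m a' l" by blast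
  have "\<exists>p\<in>{1..m}. n < p \<and> l p \<noteq> 0"
  proof (rule ccontr)
    assume none: "\<not> ?thesis"
    have zero: "l p = 0" if "p \<in> {1..m}" "n < p" for p using that none by blast
    have "l i *\<^sub>R a' i \<in> span (z ` {1..<Suc n})" if "i \<in> {1..m}" for i
    proof (cases "i \<le> n")
      case True
      then show ?thesis using a' that by (intro span_scale span_base) auto
    qed (use that zero[of i] in \<open>simp add: span_zero\<close>)
    then have "z (Suc n) \<in> span (z ` {1..<Suc n})"
      unfolding l(2) lin_map_def by (intro span_sum) auto
    then show False using Suc.prems(2)[of "Suc n"] by simp
  qed
  then obtain p where p: "p \<in> {1..m}" "n < p" "l p \<noteq> 0" by blast
  define a1 where "a1 = a'(p := z (Suc n))"
  define c1 where "c1 = c'(p := dot m c' l)"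
  have "reform_step m K (a', b, c') (a1, b, c1)"
    unfolding a1_def c1_def l(2) using p l(1) by (intro reform_step.combine) auto
  with ref have ref1: "reformulation m K (a, b, c) (a1, b, c1)"
    unfolding reformulation_def by (rule rtranclp.rtrancl_into_rtrancl)
  have spn1: "span (a1 ` {1..m}) = span (a ` {1..m})"
    unfolding a1_def l(2) using span_exchange[of p m l a'] p spn by simp
  have c1: "\<forall>i\<in>{1..m}. c1 i = a1 i \<bullet> y0"
    using c' inner_lin_map[of m a' y0 c' l] by (simp add: a1_def c1_def l(2))
  define a2 where "a2 = a1(p := a1 (Suc n), Suc n := a1 p)"
  define c2 where "c2 = c1(p := c1 (Suc n), Suc n := c1 p)"
  have Sn: "Suc n \<in> {1..m}" using p by auto
  have "reformulation m K (a, b, c) (a2, b, c2)"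
  proof (cases "p = Suc n")
    case True
    then show ?thesis using ref1 by (simp add: a2_def c2_def)
  next
    case False
    then have "reform_step m K (a1, b, c1) (a2, b, c2)"
      unfolding a2_def c2_def using p Sn by (intro reform_step.switch) auto
    with ref1 show ?thesis
      unfolding reformulation_def by (rule rtranclp.rtrancl_into_rtrancl)
  qed
  moreover have "\<forall>i\<in>{1..Suc n}. a2 i = z i"
    using a' p by (auto simp: a2_def a1_def)
  moreover have "a2 ` {1..m} = a1 ` {1..m}"
  proof -
    have "a2 = a1 \<circ> Transposition.transpose p (Suc n)"
      by (auto simp: a2_def Transposition.transpose_def fun_eq_iff)
    moreover have "Transposition.transpose p (Suc n) ` {1..m} = {1..m}"
      using p Sn by (simp add: transpose_image_eq)
    ultimately show ?thesis by (metis image_comp)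
  qed
  moreover have "\<forall>i\<in>{1..m}. c2 i = a2 i \<bullet> y0"
    using c1 p Sn by (simp add: a2_def c2_def)
  ultimately show ?case using Sn spn1 by (intro conjI exI[of _ a2] exI[of _ c2]) auto
qed

section \<open>The two certificates\<close>

theorem theoremI:
  fixes K :: "'a::euclidean_space set"
    and m :: nat
    and a :: "nat \<Rightarrow> 'a"
    and b :: 'a
    and c :: "nat \<Rightarrow> real"
  assumes "closed K"
    and "convex_cone K"
    and "inj_on (lin_map m a) (Rvec m)"
    and "c \<in> Rvec m"
  shows "(\<not> D_feasible m K a c \<longleftrightarrow>
            (\<exists>a' b' c' k. reformulation m K (a, b, c) (a', b', c')
               \<and> k + 1 \<le> m
               \<and> (\<forall>i\<in>{1..k}. c' i = 0) \<and> c' (k + 1) = -1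
               \<and> a' \<in> FR (k + 1) (dual_cone K)))
       \<and> (\<not> D_strongly_infeasible m K a c \<longleftrightarrow>
            (\<exists>l y. y \<in> FR (l + 1) K
               \<and> (\<forall>i\<in>{1..l}. adj_map m a (y i) = zero_vec m)
               \<and> adj_map m a (y (l + 1)) = c))"
proof -
  define R where "R = span (a ` {1..m})"
  have R: "subspace R" by (simp add: R_def)
  obtain y0 where y0: "\<And>i. i \<in> {1..m} \<Longrightarrow> a i \<bullet> y0 = c i"
    using exists_preimage_adjoint[OF assms(3)] by metis
  have feasible_iff: "D_feasible m K a c \<longleftrightarrow> (\<exists>y\<in>dual_cone K. \<forall>i\<in>{1..m}. a i \<bullet> y = c i)"
    by (simp add: D_feasible_def adj_map_eq_iff[OF assms(4)])
  have zero_vec: "adj_map m a y = zero_vec m \<longleftrightarrow> (\<forall>i\<in>{1..m}. a i \<bullet> y = 0)" for y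
    by (subst adj_map_eq_iff) (auto simp: zero_vec_def Rvec_def)
  have part1: "\<not> D_feasible m K a c \<longleftrightarrow>
            (\<exists>a' b' c' k. reformulation m K (a, b, c) (a', b', c')
               \<and> k + 1 \<le> m
               \<and> (\<forall>i\<in>{1..k}. c' i = 0) \<and> c' (k + 1) = -1
               \<and> a' \<in> FR (k + 1) (dual_cone K))" (is "_ \<longleftrightarrow> ?R1")
  proof
    assume infeasible: "\<not> D_feasible m K a c"
    have zero_dual: "0 \<in> dual_cone K" by (simp add: dual_cone_def)
    have "y0 \<notin> orthogonal_comp R"
    proof
      assume "y0 \<in> orthogonal_comp R"
      then have "\<forall>i\<in>{1..m}. a i \<bullet> 0 = c i"
        using y0 by (simp add: R_def in_orthogonal_comp_span_iff)
      then show False using infeasible zero_dual by (auto simp: feasible_iff)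
    qed
    then obtain r where r: "r \<in> R" "r \<bullet> y0 \<noteq> 0" by (auto simp: orthogonal_comp_iff)
    define f where "f = (- 1 / (r \<bullet> y0)) *\<^sub>R r"
    have f: "f \<in> R" "f \<bullet> y0 = -1"
      using r subspace_neg[OF R] subspace_scale[OF R] by (simp_all add: f_def)
    define W where "W = R \<inter> orthogonal_comp {y0}"
    have W: "subspace W"
      unfolding W_def by (intro subspace_inter R subspace_orthogonal_comp)
    have W_iff: "w \<in> W \<longleftrightarrow> w \<in> R \<and> w \<bullet> y0 = 0" for w
      by (simp add: W_def orthogonal_comp_iff inner_commute)
    have "0 \<le> f \<bullet> x" if x: "x \<in> dual_cone K \<inter> orthogonal_comp W" for x
    proof (rule ccontr)
      assume neg: "\<not> 0 \<le> f \<bullet> x"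
      define y where "y = (- 1 / (f \<bullet> x)) *\<^sub>R x"
      have "y \<in> dual_cone K"
        unfolding y_def using x neg
        by (intro convex_cone_scaleR[OF convex_cone_dual_cone]) auto
      moreover have "a i \<bullet> y = c i" if i: "i \<in> {1..m}" for i
      proof -
        \<comment> \<open>The multiple of \<open>f\<close> is the one for which the sum is orthogonal to \<open>y0\<close>.\<close>
        have "a i + c i *\<^sub>R f \<in> W"
          using i f y0[OF i] subspace_add[OF R] subspace_scale[OF R]
          by (simp add: W_iff inner_add_left R_def span_base)
        then have "(a i + c i *\<^sub>R f) \<bullet> x = 0" using x by (simp add: orthogonal_comp_iff)
        then have "a i \<bullet> x = - c i * (f \<bullet> x)" by (simp add: inner_add_left)
        then show ?thesis using neg by (simp add: y_def)
      qed
      ultimately show False using infeasible by (auto simp: feasible_iff)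
    qed
    then obtain k z where z: "z \<in> FR (k + 1) (dual_cone K)" "\<forall>i\<in>{1..k}. z i \<in> W"
      "z (k + 1) - f \<in> W"
      "\<forall>i\<in>{1..k}. \<exists>x\<in>dual_cone K \<inter> orthogonal_comp (z ` {1..<i}). 0 < z i \<bullet> x"
      using facial_reduction[OF convex_cone_dual_cone W] by blast
    have last: "z (k + 1) \<in> R" "z (k + 1) \<bullet> y0 = -1"
      using z(3) f subspace_add[OF R, of "z (k + 1) - f" f] by (simp_all add: W_iff inner_diff_left)
    have inR: "z i \<in> span (a ` {1..m})" if "i \<in> {1..k + 1}" for i
    proof (cases "i = k + 1")
      case False
      with that have "i \<in> {1..k}" by auto
      with z(2) show ?thesis by (simp add: W_iff R_def)
    qed (use last in \<open>simp add: R_def\<close>)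
    have indep: "z i \<notin> span (z ` {1..<i})" if i: "i \<in> {1..k + 1}" for i
    proof (cases "i = k + 1")
      case True
      have "span (z ` {1..<i}) \<subseteq> W"
        by (intro span_minimal W) (use z(2) True in auto)
      then show ?thesis using True last by (auto simp: W_iff)
    next
      case False
      with i have "i \<in> {1..k}" by auto
      with z(4) obtain x where x: "x \<in> orthogonal_comp (z ` {1..<i})" "0 < z i \<bullet> x" by blast
      then have "x \<in> orthogonal_comp (span (z ` {1..<i}))"
        unfolding in_orthogonal_comp_span_iff by (simp add: orthogonal_comp_iff)
      then show ?thesis using x(2) by (auto simp: orthogonal_comp_iff)
    qed
    obtain a' c' where ref: "k + 1 \<le> m" "reformulation m K (a, b, c) (a', b, c')"
      "\<forall>i\<in>{1..k + 1}. a' i = z i" "\<forall>i\<in>{1..m}. c' i = a' i \<bullet> y0"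
      using reformulation_to_independent_sequence[of m a y0 c "k + 1" z K b] y0 inR indep by blast
    have "a' \<in> FR (k + 1) (dual_cone K)"
    proof -
      have "a' ` {1..<i} = z ` {1..<i}" if "i \<in> {1..k + 1}" for i
        using that ref(3) by (intro image_cong) auto
      then show ?thesis using z(1) ref(3) by (simp add: FR_def)
    qed
    moreover have "\<forall>i\<in>{1..k}. c' i = 0" using ref z(2) by (simp add: W_iff)
    moreover have "c' (k + 1) = -1" using ref last by simp
    ultimately show ?R1 using ref(1,2) by blast
  next
    assume ?R1
    then obtain a' b' c' k where ref: "reformulation m K (a, b, c) (a', b', c')" "k + 1 \<le> m"
      "\<forall>i\<in>{1..k}. c' i = 0" "c' (k + 1) = -1" "a' \<in> FR (k + 1) (dual_cone K)" by blast
    show "\<not> D_feasible m K a c"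
    proof
      assume "D_feasible m K a c"
      then obtain y where y: "y \<in> dual_cone K" "\<forall>i\<in>{1..m}. a' i \<bullet> y = c' i"
        using reformulation_feasible[OF ref(1)] by (auto simp: feasible_iff)
      have "0 \<le> a' (k + 1) \<bullet> y"
        using ref(2,3) y by (intro FR_last_nonneg[OF ref(5)]) auto
      then show False using y(2) ref(2,4) by simp
    qed
  qed
  have part2: "\<not> D_strongly_infeasible m K a c \<longleftrightarrow>
            (\<exists>l y. y \<in> FR (l + 1) K
               \<and> (\<forall>i\<in>{1..l}. adj_map m a (y i) = zero_vec m)
               \<and> adj_map m a (y (l + 1)) = c)" (is "_ \<longleftrightarrow> ?R2")
  proof
    assume nsi: "\<not> D_strongly_infeasible m K a c"
    have "0 \<le> y0 \<bullet> x" if x: "x \<in> K \<inter> orthogonal_comp (orthogonal_comp R)" for x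
    proof (rule ccontr)
      assume neg: "\<not> 0 \<le> y0 \<bullet> x"
      define w where "w = (- 1 / (y0 \<bullet> x)) *\<^sub>R x"
      have "w \<in> K"
        unfolding w_def using x neg by (intro convex_cone_scaleR[OF assms(2)]) auto
      moreover have "w \<in> lin_map m a ` Rvec m"
        using x subspace_neg[OF R] subspace_scale[OF R]
        by (simp add: range_lin_map w_def orthogonal_comp_self[OF R] flip: R_def)
      then obtain l where l: "l \<in> Rvec m" "w = lin_map m a l" by blast
      moreover have "dot m c l = -1"
        using inner_lin_map[of m a y0 c l] y0 l neg by (simp add: w_def inner_commute flip: l(2))
      ultimately show False using nsi by (auto simp: D_strongly_infeasible_def)
    qed
    then obtain l y where y: "y \<in> FR (l + 1) K" "\<forall>i\<in>{1..l}. y i \<in> orthogonal_comp R"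
      "y (l + 1) - y0 \<in> orthogonal_comp R"
      using facial_reduction[OF assms(2) subspace_orthogonal_comp] by blast
    have "\<forall>i\<in>{1..l}. adj_map m a (y i) = zero_vec m"
      using y(2) by (simp add: zero_vec R_def in_orthogonal_comp_span_iff)
    moreover have "adj_map m a (y (l + 1)) = c"
      using y(3) y0
      by (simp add: adj_map_eq_iff[OF assms(4)] R_def in_orthogonal_comp_span_iff inner_diff_right)
    ultimately show ?R2 using y(1) by blast
  next
    assume ?R2
    then obtain l y where y: "y \<in> FR (l + 1) K" "\<forall>i\<in>{1..l}. adj_map m a (y i) = zero_vec m"
      "adj_map m a (y (l + 1)) = c" by blast
    show "\<not> D_strongly_infeasible m K a c"
    proof
      assume "D_strongly_infeasible m K a c"
      then obtain x where x: "lin_map m a x \<in> K" "dot m c x = -1"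
        by (auto simp: D_strongly_infeasible_def)
      have "0 \<le> y (l + 1) \<bullet> lin_map m a x"
      proof (rule FR_last_nonneg[OF y(1) x(1)])
        fix i assume "i \<in> {1..l}"
        then have "y i \<bullet> lin_map m a x = dot m (zero_vec m) x"
          using y(2) by (simp flip: adj_map_adjoint)
        then show "y i \<bullet> lin_map m a x = 0" by (simp add: dot_def zero_vec_def)
      qed
      then show False using y(3) x(2) by (simp flip: adj_map_adjoint)
    qed
  qed
  from part1 part2 show ?thesis by (rule conjI)
qed

end
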